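(* Let $R$ be a commutative Noetherian ring and let $N$ be a non-zero finitely generated $R$-module. Then the following conditions are equivalent: (i) For every $N$-proper ideal $\mathfrak{b}$ of $R$, the $\mathfrak{b}$-symbolic topology on $N$ is linearly equivalent to the $\mathfrak{b}$-adic topology on $N$. (ii) $\dim N\leq 1$, and for every $\mathfrak{p}\in\operatorname{Supp}(N)$ the set $\operatorname{Ass}_{R_{\mathfrak{p}}}N_{\mathfrak{p}}$ consists of a single prime ideal.
   Context: An ideal $\mathfrak{b}$ of $R$ is $N$-proper if $N/\mathfrak{b}N\neq 0$. For an ideal $\mathfrak{b}$ and an integer $n\ge 0$, the $n$th symbolic power of $\mathfrak{b}$ with respect to $N$, denoted $(\mathfrak{b}N)^{(n)}$, is the intersection of those primary components of $\mathfrak{b}^nN$ (in a minimal primary decomposition of the submodule $\mathfrak{b}^nN$ of $N$) which correspond to the minimal elements of $\operatorname{Ass}_R N/\mathfrak{b}N$. The $\mathfrak{b}$-adic topology on $N$ is the topology defined by the filtration $\{\mathfrak{b}^nN\}_{n\ge0}$ and the $\mathfrak{b}$-symbolic topology is the one defined by $\{(\mathfrak{b}N)^{(n)}\}_{n\ge 0}$. These two topologies are linearly equivalent if there is an integer $k\ge 0$ such that $(\mathfrak{b}N)^{(n+k)}\subseteq\mathfrak{b}^nN$ for all integers $n\ge 0$. *)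

theory Defs
  imports Complex_Main
begin

text \<open>Commutative rings are types of class comm_ring_1; an R-module N is a type 'b
  of class ab_group_add with a scalar multiplication satisfying the locale module.\<close>

definition is_ideal :: "'a::comm_ring_1 set \<Rightarrow> bool" where
  "is_ideal I \<longleftrightarrow> 0 \<in> I \<and> (\<forall>x\<in>I. \<forall>y\<in>I. x + y \<in> I) \<and> (\<forall>r. \<forall>x\<in>I. r * x \<in> I)"

definition ideal_gen :: "'a::comm_ring_1 set \<Rightarrow> 'a set" where
  "ideal_gen S = \<Inter>{J. is_ideal J \<and> S \<subseteq> J}"

definition prime_ideal :: "'a::comm_ring_1 set \<Rightarrow> bool" where
  "prime_ideal P \<longleftrightarrow> is_ideal P \<and> P \<noteq> UNIV \<and> (\<forall>a b. a * b \<in> P \<longrightarrow> a \<in> P \<or> b \<in> P)"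

definition noetherian_ring :: "'a::comm_ring_1 itself \<Rightarrow> bool" where
  "noetherian_ring _ \<longleftrightarrow> (\<forall>I::'a set. is_ideal I \<longrightarrow> (\<exists>S. finite S \<and> I = ideal_gen S))"

definition fin_gen_module :: "('a::comm_ring_1 \<Rightarrow> 'b::ab_group_add \<Rightarrow> 'b) \<Rightarrow> bool" where
  "fin_gen_module scale \<longleftrightarrow> (\<exists>S. finite S \<and> module.span scale S = UNIV)"

fun ideal_pow :: "'a::comm_ring_1 set \<Rightarrow> nat \<Rightarrow> 'a set" where
  "ideal_pow I 0 = UNIV"
| "ideal_pow I (Suc n) = ideal_gen {a * c | a c. a \<in> I \<and> c \<in> ideal_pow I n}"

definition ideal_smult :: "('a::comm_ring_1 \<Rightarrow> 'b::ab_group_add \<Rightarrow> 'b) \<Rightarrow> 'a set \<Rightarrow> 'b set \<Rightarrow> 'b set" where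
  "ideal_smult scale I L = module.span scale {scale r x | r x. r \<in> I \<and> x \<in> L}"

definition pow_submod :: "('a::comm_ring_1 \<Rightarrow> 'b::ab_group_add \<Rightarrow> 'b) \<Rightarrow> 'a set \<Rightarrow> nat \<Rightarrow> 'b set" where
  "pow_submod scale I n = ideal_smult scale (ideal_pow I n) UNIV"

text \<open>Ass_R (N/L): primes of the form ann_R(x + L) = (L :_R x).\<close>
definition Ass_quot :: "('a::comm_ring_1 \<Rightarrow> 'b::ab_group_add \<Rightarrow> 'b) \<Rightarrow> 'b set \<Rightarrow> 'a set set" where
  "Ass_quot scale L = {P. prime_ideal P \<and> (\<exists>x. P = {r. scale r x \<in> L})}"

definition min_Ass_quot :: "('a::comm_ring_1 \<Rightarrow> 'b::ab_group_add \<Rightarrow> 'b) \<Rightarrow> 'b set \<Rightarrow> 'a set set" where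
  "min_Ass_quot scale L = {P \<in> Ass_quot scale L. \<forall>P' \<in> Ass_quot scale L. P' \<subseteq> P \<longrightarrow> P' = P}"

definition primary_submod :: "('a::comm_ring_1 \<Rightarrow> 'b::ab_group_add \<Rightarrow> 'b) \<Rightarrow> 'b set \<Rightarrow> bool" where
  "primary_submod scale Q \<longleftrightarrow> module.subspace scale Q \<and> Q \<noteq> UNIV \<and>
     (\<forall>r x. scale r x \<in> Q \<longrightarrow> x \<notin> Q \<longrightarrow> (\<exists>n. \<forall>y. scale (r ^ n) y \<in> Q))"

definition primary_prime :: "('a::comm_ring_1 \<Rightarrow> 'b::ab_group_add \<Rightarrow> 'b) \<Rightarrow> 'b set \<Rightarrow> 'a set" where
  "primary_prime scale Q = {r. \<exists>n. \<forall>y. scale (r ^ n) y \<in> Q}"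

definition min_primary_dec :: "('a::comm_ring_1 \<Rightarrow> 'b::ab_group_add \<Rightarrow> 'b) \<Rightarrow> 'b set \<Rightarrow> 'b set set \<Rightarrow> bool" where
  "min_primary_dec scale L D \<longleftrightarrow> finite D \<and> (\<forall>Q\<in>D. primary_submod scale Q) \<and> \<Inter>D = L
     \<and> inj_on (primary_prime scale) D \<and> (\<forall>Q\<in>D. \<Inter>(D - {Q}) \<noteq> L)"

definition symb_power :: "('a::comm_ring_1 \<Rightarrow> 'b::ab_group_add \<Rightarrow> 'b) \<Rightarrow> 'a set \<Rightarrow> nat \<Rightarrow> 'b set" where
  "symb_power scale I n =
     (let D = (SOME D. min_primary_dec scale (pow_submod scale I n) D)
      in \<Inter>{Q \<in> D. primary_prime scale Q \<in> min_Ass_quot scale (pow_submod scale I 1)})"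

definition N_proper :: "('a::comm_ring_1 \<Rightarrow> 'b::ab_group_add \<Rightarrow> 'b) \<Rightarrow> 'a set \<Rightarrow> bool" where
  "N_proper scale I \<longleftrightarrow> pow_submod scale I 1 \<noteq> UNIV"

definition lin_equiv_topologies :: "('a::comm_ring_1 \<Rightarrow> 'b::ab_group_add \<Rightarrow> 'b) \<Rightarrow> 'a set \<Rightarrow> bool" where
  "lin_equiv_topologies scale I \<longleftrightarrow> (\<exists>k. \<forall>n. symb_power scale I (n + k) \<subseteq> pow_submod scale I n)"

text \<open>Supp N = {p prime : N_p \<noteq> 0}; written out: some x/1 \<noteq> 0 in N_p, i.e. ann(x) \<subseteq> p.\<close>
definition Supp :: "('a::comm_ring_1 \<Rightarrow> 'b::ab_group_add \<Rightarrow> 'b) \<Rightarrow> 'a set set" where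
  "Supp scale = {P. prime_ideal P \<and> (\<exists>x. {r. scale r x = 0} \<subseteq> P)}"

definition dim_le_one :: "('a::comm_ring_1 \<Rightarrow> 'b::ab_group_add \<Rightarrow> 'b) \<Rightarrow> bool" where
  "dim_le_one scale \<longleftrightarrow> \<not> (\<exists>P0 P1 P2. P0 \<in> Supp scale \<and> P1 \<in> Supp scale \<and> P2 \<in> Supp scale
      \<and> P0 \<subset> P1 \<and> P1 \<subset> P2)"

text \<open>Ass_{R_p} N_p, described through the bijection q R_p \<leftrightarrow> q between primes of R_p and
  primes q \<subseteq> p of R: q R_p = ann_{R_p}(x/s) iff q is the contraction
  {r. r/1 \<cdot> x/1 = 0 in N_p} = {r. \<exists>u \<notin> p. u r x = 0}.\<close>
definition loc_Ass :: "('a::comm_ring_1 \<Rightarrow> 'b::ab_group_add \<Rightarrow> 'b) \<Rightarrow> 'a set \<Rightarrow> 'a set set" where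
  "loc_Ass scale P = {Q. prime_ideal Q \<and> Q \<subseteq> P \<and>
      (\<exists>x. Q = {r. \<exists>u. u \<notin> P \<and> scale (u * r) x = 0})}"

end

theory Submission
  imports Defs
begin

text \<open>
  If the topologies are linearly equivalent for a minimal prime \<open>q\<close> of \<open>Supp N\<close>, the kernel of
  \<open>N \<rightarrow> N\<^sub>q\<close>, which lies in all symbolic powers, lies in all \<open>q^n N\<close>; Krull's intersection theorem then
  shows that every associated prime other than \<open>q\<close> is comaximal with \<open>q\<close>. A chain \<open>P0 \<subset> P1 \<subset> P2\<close> in
  \<open>Supp N\<close> is excluded by the ideal \<open>a P2\<close> with \<open>a \<in> P1 - P0\<close>. Conversely, under (ii) an embedded prime
  \<open>p\<close> of \<open>b^n N\<close> contains a minimal prime \<open>q \<supseteq> b\<close> of \<open>Supp N\<close> with \<open>Ass N\<^sub>p = {q}\<close>. Then \<open>b^n\<close> kills \<open>N\<^sub>p\<close>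
  for \<open>n\<close> large, uniformly in \<open>p\<close>, so \<open>p\<close> would be associated to \<open>N\<^sub>p\<close>; hence \<open>b^n N\<close> has no embedded
  components for large \<open>n\<close>.
\<close>

section \<open>Ideals, their powers, and prime ideals\<close>

lemma module_mult: "module ((*) :: 'a::comm_ring_1 \<Rightarrow> 'a \<Rightarrow> 'a)"
  by unfold_locales (simp_all add: algebra_simps)

text \<open>Viewing ideals as submodules of the ring lets the general maximality result for modules
  be applied to families of ideals as well.\<close>

lemma is_ideal_iff_subspace: "is_ideal I \<longleftrightarrow> module.subspace (*) I"
  unfolding is_ideal_def module.subspace_def[OF module_mult] by blast

lemma is_idealI:
  assumes "0 \<in> I" "\<And>x y. x \<in> I \<Longrightarrow> y \<in> I \<Longrightarrow> x + y \<in> I" "\<And>r x. x \<in> I \<Longrightarrow> r * x \<in> I"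
  shows "is_ideal I"
  using assms unfolding is_ideal_def by blast

lemma is_ideal_ideal_gen: "is_ideal (ideal_gen S)"
  unfolding is_ideal_def ideal_gen_def by blast

lemma ideal_gen_superset: "S \<subseteq> ideal_gen S"
  unfolding ideal_gen_def by blast

lemma ideal_gen_minimal: "S \<subseteq> J \<Longrightarrow> is_ideal J \<Longrightarrow> ideal_gen S \<subseteq> J"
  unfolding ideal_gen_def by blast

lemma ideal_gen_eq_span: "ideal_gen S = module.span (*) S"
proof
  show "ideal_gen S \<subseteq> module.span (*) S"
    by (rule ideal_gen_minimal)
      (auto simp: is_ideal_iff_subspace module.subspace_span[OF module_mult]
        intro: module.span_base[OF module_mult])
  show "module.span (*) S \<subseteq> ideal_gen S"
    using module.span_minimal[OF module_mult ideal_gen_superset] is_ideal_ideal_gen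
    unfolding is_ideal_iff_subspace by blast
qed

lemma is_ideal_ideal_pow: "is_ideal (ideal_pow I n)"
  by (cases n) (simp_all add: is_ideal_ideal_gen, simp add: is_ideal_def)

lemma ideal_pow_SucI: "a \<in> I \<Longrightarrow> c \<in> ideal_pow I n \<Longrightarrow> a * c \<in> ideal_pow I (Suc n)"
  using ideal_gen_superset[of "{a * c |a c. a \<in> I \<and> c \<in> ideal_pow I n}"] by auto

lemma ideal_pow_Suc_subset:
  assumes "is_ideal J" "\<And>a c. a \<in> I \<Longrightarrow> c \<in> ideal_pow I n \<Longrightarrow> a * c \<in> J"
  shows "ideal_pow I (Suc n) \<subseteq> J"
  unfolding ideal_pow.simps by (rule ideal_gen_minimal) (use assms in auto)

lemma power_in_ideal_pow: "a \<in> I \<Longrightarrow> a ^ n \<in> ideal_pow I n"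
  by (induction n) (auto intro: ideal_pow_SucI simp del: ideal_pow.simps(2))

lemma ideal_pow_add_subset: "ideal_pow I (n + k) \<subseteq> ideal_pow I n"
proof (induction n)
  case (Suc n)
  show ?case unfolding add_Suc
    by (rule ideal_pow_Suc_subset[OF is_ideal_ideal_pow])
      (use Suc in \<open>auto intro: ideal_pow_SucI simp del: ideal_pow.simps(2)\<close>)
qed simp

lemma prime_ideal_is_ideal: "prime_ideal P \<Longrightarrow> is_ideal P"
  unfolding prime_ideal_def by blast

lemma prime_ideal_one: "prime_ideal P \<Longrightarrow> 1 \<notin> P"
  unfolding prime_ideal_def is_ideal_def by (metis UNIV_eq_I mult.right_neutral)

lemma prime_ideal_mult_notin: "prime_ideal P \<Longrightarrow> a \<notin> P \<Longrightarrow> b \<notin> P \<Longrightarrow> a * b \<notin> P"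
  unfolding prime_ideal_def by blast

lemma prime_ideal_mult_iff: "prime_ideal P \<Longrightarrow> a * b \<in> P \<longleftrightarrow> a \<in> P \<or> b \<in> P"
  unfolding prime_ideal_def is_ideal_def by (metis mult.commute)

lemma prime_ideal_power: "prime_ideal P \<Longrightarrow> a ^ n \<in> P \<Longrightarrow> a \<in> P"
  by (induction n) (auto simp: prime_ideal_one prime_ideal_mult_iff)

lemma prime_ideal_prod_notin:
  assumes "prime_ideal P" "finite A" "\<And>x. x \<in> A \<Longrightarrow> f x \<notin> P"
  shows "prod f A \<notin> P"
  using assms(2,3)
  by (induction A) (auto simp: prime_ideal_one[OF assms(1)] prime_ideal_mult_iff[OF assms(1)])

lemma prime_ideal_diff_notin:
  assumes "prime_ideal P" "u \<notin> P" "c \<in> P"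
  shows "u - c \<notin> P"
  using assms unfolding prime_ideal_def is_ideal_def by (metis diff_add_cancel)

section \<open>The submodules \<open>I^n N\<close> and finite generation over a Noetherian
  ring\<close>

context module
begin

lemma is_ideal_colon: "subspace L \<Longrightarrow> is_ideal {r. r *s x \<in> L}"
  by (rule is_idealI) (auto simp: scale_left_distrib subspace_0 subspace_add subspace_scale
      simp flip: scale_scale)

lemma subspace_preimage_scale: "subspace L \<Longrightarrow> subspace {x. r *s x \<in> L}"
  unfolding subspace_def
  by (simp only: scale_right_distrib scale_left_commute[of r] mem_Collect_eq scale_zero_right) blast

lemma subspace_pow_submod: "subspace (pow_submod scale I n)"
  unfolding pow_submod_def ideal_smult_def by (rule subspace_span)

lemma span_subset_iff: "subspace L \<Longrightarrow> span S \<subseteq> L \<longleftrightarrow> S \<subseteq> L"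
  using span_minimal span_superset by blast

lemma pow_submod_subset_iff:
  "subspace L \<Longrightarrow> pow_submod scale I n \<subseteq> L \<longleftrightarrow> (\<forall>r\<in>ideal_pow I n. \<forall>y. r *s y \<in> L)"
  unfolding pow_submod_def ideal_smult_def by (subst span_subset_iff) auto

lemma scale_in_pow_submod: "r \<in> ideal_pow I n \<Longrightarrow> r *s y \<in> pow_submod scale I n"
  using pow_submod_subset_iff[OF subspace_pow_submod] by blast

lemma pow_submod_1_subset: "subspace L \<Longrightarrow> (\<And>r y. r \<in> I \<Longrightarrow> r *s y \<in> L) \<Longrightarrow> pow_submod scale I 1 \<subseteq> L"
  unfolding pow_submod_subset_iff One_nat_def
proof (intro ballI allI)
  fix r y
  assume L: "subspace L" "\<And>r y. r \<in> I \<Longrightarrow> r *s y \<in> L" and r: "r \<in> ideal_pow I (Suc 0)"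
  have "ideal_pow I (Suc 0) \<subseteq> {r. r *s y \<in> L}"
    by (rule ideal_pow_Suc_subset[OF is_ideal_colon[OF L(1)]]) (simp add: L(2) flip: scale_scale)
  then show "r *s y \<in> L" using r by blast
qed

lemma pow_submod_add_subset: "pow_submod scale I (n + k) \<subseteq> pow_submod scale I n"
  unfolding pow_submod_subset_iff[OF subspace_pow_submod]
  using ideal_pow_add_subset scale_in_pow_submod by blast

text \<open>Zorn's lemma applies: the union of a chain of submodules is finitely generated, so a
  single member already contains the generators and equals the union.\<close>

lemma finitely_generated_imp_maximal:
  assumes fg: "\<And>L. subspace L \<Longrightarrow> \<exists>T. finite T \<and> L = span T"
    and ne: "\<A> \<noteq> {}" and sub: "\<And>L. L \<in> \<A> \<Longrightarrow> subspace L"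
  shows "\<exists>M\<in>\<A>. \<forall>X\<in>\<A>. M \<subseteq> X \<longrightarrow> X = M"
proof (rule subset_Zorn_nonempty[OF ne])
  fix C assume C: "C \<noteq> {}" "subset.chain \<A> C"
  have mem: "L \<in> C \<Longrightarrow> L \<in> \<A>" for L using C(2) by (auto simp: subset.chain_def)
  have lin: "X \<in> C \<Longrightarrow> Y \<in> C \<Longrightarrow> X \<subseteq> Y \<or> Y \<subseteq> X" for X Y
    using C(2) by (auto simp: subset_chain_def)
  have subC: "L \<in> C \<Longrightarrow> subspace L" for L using mem sub by blast
  have "subspace (\<Union>C)"
  proof (rule subspaceI)
    show "0 \<in> \<Union>C" using C(1) subspace_0[OF subC] by blast
    show "x + y \<in> \<Union>C" if xy: "x \<in> \<Union>C" "y \<in> \<Union>C" for x y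
    proof -
      obtain X Y where XY: "X \<in> C" "x \<in> X" "Y \<in> C" "y \<in> Y" using xy by blast
      then obtain Z where "Z \<in> C" "x \<in> Z" "y \<in> Z" using lin[of X Y] by blast
      then show ?thesis using subspace_add[OF subC] by blast
    qed
    show "c *s x \<in> \<Union>C" if "x \<in> \<Union>C" for c x
      using that subspace_scale[OF subC] by blast
  qed
  then obtain T where T: "finite T" "\<Union>C = span T" using fg[of "\<Union>C"] by auto
  have "T \<subseteq> \<Union>C" unfolding T(2) by (rule span_superset)
  then obtain M where M: "M \<in> C" "T \<subseteq> M"
    using finite_subset_Union_chain[OF T(1) _ C] by blast
  have "\<Union>C \<subseteq> M" unfolding T(2) by (rule span_minimal[OF M(2) subC[OF M(1)]])
  then have "\<Union>C = M" using M by blast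
  then show "\<Union>C \<in> \<A>" using M mem by blast
qed

text \<open>Induction on the generators of the ambient span. The coefficients at the new generator
  \<open>s\<close> form a finitely generated ideal; lifts of its generators to \<open>L\<close>,
  together with generators of \<open>L \<inter> span S\<close>, generate \<open>L\<close>.\<close>

lemma subspace_of_span_finitely_generated:
  assumes R: "noetherian_ring TYPE('a)" and "finite S"
  shows "subspace L \<Longrightarrow> L \<subseteq> span S \<Longrightarrow> \<exists>T. finite T \<and> L = span T"
  using \<open>finite S\<close>
proof (induction S arbitrary: L)
  case empty
  then have "L = span {}" using subspace_0 by auto
  then show ?case by blast
next
  case (insert s S)
  define J where "J = {r. \<exists>y\<in>span S. r *s s + y \<in> L}"
  have "is_ideal J"
  proof (rule is_idealI)
    show "0 \<in> J" unfolding J_def using span_zero subspace_0[OF insert.prems(1)] by force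
    show "a + b \<in> J" if ab: "a \<in> J" "b \<in> J" for a b
    proof -
      obtain y z where yz: "y \<in> span S" "a *s s + y \<in> L" "z \<in> span S" "b *s s + z \<in> L"
        using ab J_def by blast
      then have "(a + b) *s s + (y + z) \<in> L" "y + z \<in> span S"
        using subspace_add[OF insert.prems(1) yz(2,4)] span_add
        by (simp_all add: scale_left_distrib algebra_simps)
      then show ?thesis unfolding J_def by blast
    qed
    show "r * a \<in> J" if a: "a \<in> J" for r a
    proof -
      obtain y where y: "y \<in> span S" "a *s s + y \<in> L" using a J_def by blast
      then have "(r * a) *s s + r *s y \<in> L" "r *s y \<in> span S"
        using subspace_scale[OF insert.prems(1) y(2), of r] span_scale
        by (simp_all add: scale_right_distrib)
      then show ?thesis unfolding J_def by blast
    qed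
  qed
  then obtain F where F: "finite F" "J = ideal_gen F" using R unfolding noetherian_ring_def by blast
  then have "\<forall>f\<in>F. \<exists>y\<in>span S. f *s s + y \<in> L" using ideal_gen_superset J_def by blast
  then obtain y where y: "\<And>f. f \<in> F \<Longrightarrow> y f \<in> span S" "\<And>f. f \<in> F \<Longrightarrow> f *s s + y f \<in> L" by metis
  define U where "U = (\<lambda>f. f *s s + y f) ` F"
  have "subspace (L \<inter> span S)" using insert.prems(1) subspace_inter subspace_span by blast
  then obtain T where T: "finite T" "L \<inter> span S = span T" using insert.IH by blast
  \<comment> \<open>Coefficients of \<open>s\<close> that are realised by elements of
    \<open>span U\<close>. Being an ideal that contains \<open>F\<close>, this set contains all of
    \<open>J\<close>.\<close>
  let ?J = "{r. \<exists>w\<in>span U. w - r *s s \<in> span S}"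
  have "is_ideal ?J"
  proof (rule is_idealI)
    show "0 \<in> ?J" using span_zero by force
    show "a + b \<in> ?J" if ab: "a \<in> ?J" "b \<in> ?J" for a b
    proof -
      obtain v w where vw: "v \<in> span U" "v - a *s s \<in> span S" "w \<in> span U" "w - b *s s \<in> span S"
        using ab by blast
      then have "(v + w) - (a + b) *s s \<in> span S"
        using span_add[OF vw(2,4)] by (simp add: scale_left_distrib algebra_simps)
      then show ?thesis using span_add vw by blast
    qed
    show "r * a \<in> ?J" if a: "a \<in> ?J" for r a
    proof -
      obtain v where v: "v \<in> span U" "v - a *s s \<in> span S" using a by blast
      then have "r *s v - (r * a) *s s \<in> span S"
        using span_scale[OF v(2), of r] by (simp add: scale_right_diff_distrib)
      then show ?thesis using span_scale v by blast
    qed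
  qed
  moreover have "F \<subseteq> ?J"
  proof
    fix f assume f: "f \<in> F"
    then have "f *s s + y f \<in> span U" unfolding U_def by (blast intro: span_base)
    then show "f \<in> ?J" using y(1)[OF f] by force
  qed
  ultimately have J: "J \<subseteq> ?J" unfolding F(2) by (rule ideal_gen_minimal[rotated])
  have UL: "U \<subseteq> L" unfolding U_def using y by blast
  have "L = span (T \<union> U)"
  proof
    have "T \<subseteq> L" using T(2) span_superset[of T] by blast
    then show "span (T \<union> U) \<subseteq> L" using UL by (intro span_minimal[OF _ insert.prems(1)]) blast
    show "L \<subseteq> span (T \<union> U)"
    proof
      fix z assume z: "z \<in> L"
      then obtain r where r: "z - r *s s \<in> span S" using insert.prems(2) span_breakdown_eq by blast
      \<comment> \<open>The coefficient of \<open>z\<close> at \<open>s\<close> belongs to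
        \<open>J\<close>; subtracting a matching \<open>w\<close> from \<open>span U\<close> leaves
        an element of \<open>L \<inter> span S\<close>.\<close>
      have "r *s s + (z - r *s s) \<in> L" using z by simp
      then have "r \<in> J" unfolding J_def using r by blast
      then obtain w where w: "w \<in> span U" "w - r *s s \<in> span S" using J by blast
      have "w \<in> L" using w(1) span_minimal[OF UL insert.prems(1)] by blast
      then have "z - w \<in> L" using z insert.prems(1) subspace_diff by blast
      moreover have "z - w \<in> span S" using span_diff[OF r w(2)] by simp
      ultimately have "z - w \<in> span T" using T(2) by blast
      then have "z - w \<in> span (T \<union> U)" "w \<in> span (T \<union> U)"
        using span_mono[of T "T \<union> U"] span_mono[of U "T \<union> U"] w by auto
      then show "z \<in> span (T \<union> U)" using span_add by fastforce
    qed
  qed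
  moreover have "finite (T \<union> U)" using T F U_def by simp
  ultimately show ?case by blast
qed

end


text \<open>For a prime \<open>P\<close> and a submodule \<open>L\<close>, this is the preimage of
  the localisation of \<open>L\<close> under the map from \<open>N\<close> to \<open>N_P\<close>.
  With \<open>L = {0}\<close> it is the kernel of that map, so statements about \<open>N_P\<close>
  can be made inside \<open>N\<close>.\<close>

definition loc_sat :: "('a::comm_ring_1 \<Rightarrow> 'b::ab_group_add \<Rightarrow> 'b) \<Rightarrow> 'a set \<Rightarrow> 'b set \<Rightarrow> 'b set" where
  "loc_sat scale P L = {x. \<exists>u. u \<notin> P \<and> scale u x \<in> L}"

section \<open>Maximal submodules, colon primes and saturation at a prime\<close>

locale noetherian_module = module scale
  for scale :: "'a::comm_ring_1 \<Rightarrow> 'b::ab_group_add \<Rightarrow> 'b" (infixr \<open>*s\<close> 75) +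
  assumes noetherian: "noetherian_ring TYPE('a)"
    and fin_gen: "fin_gen_module scale"
begin

lemma maximal_subspace:
  assumes "\<A> \<noteq> {}" "\<And>L. L \<in> \<A> \<Longrightarrow> subspace L"
  obtains M where "M \<in> \<A>" "\<forall>X\<in>\<A>. M \<subseteq> X \<longrightarrow> X = M"
proof -
  obtain S where S: "finite S" "span S = UNIV" using fin_gen unfolding fin_gen_module_def by blast
  have "\<exists>T. finite T \<and> L = span T" if "subspace L" for L
    by (rule subspace_of_span_finitely_generated[OF noetherian S(1) that]) (simp add: S(2))
  from finitely_generated_imp_maximal[OF this assms] show thesis using that by blast
qed

lemma maximal_ideal_in:
  fixes \<A> :: "'a set set"
  assumes "\<A> \<noteq> {}" "\<And>I. I \<in> \<A> \<Longrightarrow> is_ideal I"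
  obtains M where "M \<in> \<A>" "\<forall>X\<in>\<A>. M \<subseteq> X \<longrightarrow> X = M"
proof -
  have fg: "\<exists>T. finite T \<and> I = module.span (*) T" if "module.subspace (*) I" for I :: "'a set"
    using noetherian that
    unfolding noetherian_ring_def is_ideal_iff_subspace ideal_gen_eq_span by blast
  show thesis
    using module.finitely_generated_imp_maximal[OF module_mult fg assms(1)] assms(2) that
    unfolding is_ideal_iff_subspace by blast
qed

lemma subspace_plus_range_scale:
  assumes "subspace L"
  shows "subspace {z. \<exists>y. z - r *s y \<in> L}"
proof (rule subspaceI; clarsimp)
  show "\<exists>y. - (r *s y) \<in> L" by (rule exI[of _ 0]) (simp add: subspace_0[OF assms])
next
  fix x y v w assume "x - r *s v \<in> L" "y - r *s w \<in> L"
  then have "x + y - r *s (v + w) \<in> L"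
    using subspace_add[OF assms] by (fastforce simp: scale_right_distrib algebra_simps)
  then show "\<exists>z. x + y - r *s z \<in> L" by blast
next
  fix c x v assume "x - r *s v \<in> L"
  then have "c *s x - r *s c *s v \<in> L"
    using subspace_scale[OF assms, of "x - r *s v" c]
    by (simp only: scale_right_diff_distrib scale_left_commute[of r])
  then show "\<exists>z. c *s x - r *s z \<in> L" by blast
qed

text \<open>A maximal ideal \<open>M\<close> among the colon ideals of elements of
  \<open>L' - L\<close> is prime: if \<open>b \<notin> M\<close>, then \<open>b *s y\<close> is
  again in \<open>L' - L\<close> and its colon ideal contains \<open>M\<close>, hence equals
  \<open>M\<close>.\<close>

lemma colon_prime_exists:
  assumes L: "subspace L" and L': "subspace L'" "\<not> L' \<subseteq> L"
  obtains y where "y \<in> L'" "y \<notin> L" "prime_ideal {r. r *s y \<in> L}"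
proof -
  let ?A = "(\<lambda>y. {r. r *s y \<in> L}) ` (L' - L)"
  have "?A \<noteq> {}" using L'(2) by blast
  moreover have "is_ideal I" if "I \<in> ?A" for I using that is_ideal_colon[OF L] by blast
  ultimately obtain M where M: "M \<in> ?A" "\<forall>X\<in>?A. M \<subseteq> X \<longrightarrow> X = M"
    by (rule maximal_ideal_in)
  then obtain y where y: "y \<in> L'" "y \<notin> L" "M = {r. r *s y \<in> L}" by blast
  have "prime_ideal M"
    unfolding prime_ideal_def
  proof (intro conjI allI impI)
    show "is_ideal M" unfolding y(3) by (rule is_ideal_colon[OF L])
    have "1 \<notin> M" using y by simp
    then show "M \<noteq> UNIV" by blast
    show "a \<in> M \<or> b \<in> M" if ab: "a * b \<in> M" for a b
    proof (rule disjCI)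
      assume b: "b \<notin> M"
      let ?X = "{r. r *s (b *s y) \<in> L}"
      have "?X \<in> ?A" using b y subspace_scale[OF L'(1) y(1)] by blast
      moreover have "M \<subseteq> ?X"
        using subspace_scale[OF L] unfolding y(3) by (auto simp only: scale_left_commute[of _ b])
      ultimately have "?X = M" by (rule M(2)[rule_format])
      moreover have "a \<in> ?X" using ab y(3) by simp
      ultimately show "a \<in> M" by simp
    qed
  qed
  then show thesis using that y by blast
qed

lemma loc_sat_mono: "L \<subseteq> L' \<Longrightarrow> loc_sat scale P L \<subseteq> loc_sat scale P L'"
  unfolding loc_sat_def by blast

lemma loc_sat_superset:
  assumes "prime_ideal P"
  shows "L \<subseteq> loc_sat scale P L"
proof
  fix x assume "x \<in> L"
  then have "1 \<notin> P \<and> 1 *s x \<in> L" using prime_ideal_one[OF assms] by simp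
  then show "x \<in> loc_sat scale P L" unfolding loc_sat_def by blast
qed

lemma loc_sat_cancel:
  assumes "prime_ideal P" "u \<notin> P" "u *s x \<in> loc_sat scale P L"
  shows "x \<in> loc_sat scale P L"
proof -
  obtain v where "v \<notin> P" "v *s u *s x \<in> L" using assms(3) unfolding loc_sat_def by blast
  then have "v * u \<notin> P" "(v * u) *s x \<in> L" using prime_ideal_mult_notin[OF assms(1)] assms(2) by auto
  then show ?thesis unfolding loc_sat_def by blast
qed

lemma loc_sat_idem:
  assumes "prime_ideal P"
  shows "loc_sat scale P (loc_sat scale P L) = loc_sat scale P L"
proof
  show "loc_sat scale P (loc_sat scale P L) \<subseteq> loc_sat scale P L"
  proof
    fix x assume "x \<in> loc_sat scale P (loc_sat scale P L)"
    then obtain u where "u \<notin> P" "u *s x \<in> loc_sat scale P L" using loc_sat_def by blast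
    then show "x \<in> loc_sat scale P L" by (rule loc_sat_cancel[OF assms])
  qed
qed (rule loc_sat_superset[OF assms])

text \<open>One denominator serves all elements: among the submodules of elements sent into
  \<open>L\<close> by some \<open>u \<notin> P\<close>, a maximal one absorbs every other, because
  products of denominators stay outside \<open>P\<close>.\<close>

lemma loc_sat_uniform:
  assumes P: "prime_ideal P" and L: "subspace L"
  obtains u where "u \<notin> P" "loc_sat scale P L = {x. u *s x \<in> L}"
proof -
  let ?A = "(\<lambda>u. {x. u *s x \<in> L}) ` (- P)"
  have "?A \<noteq> {}" using prime_ideal_one[OF P] by blast
  moreover have "subspace X" if "X \<in> ?A" for X using that subspace_preimage_scale[OF L] by blast
  ultimately obtain M where M: "M \<in> ?A" "\<forall>X\<in>?A. M \<subseteq> X \<longrightarrow> X = M"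
    by (rule maximal_subspace)
  then obtain u where u: "u \<notin> P" "M = {x. u *s x \<in> L}" by blast
  have "x \<in> M" if v: "v \<notin> P" "v *s x \<in> L" for v x
  proof -
    let ?X = "{x. (v * u) *s x \<in> L}"
    have "v * u \<notin> P" using P v(1) u(1) by (rule prime_ideal_mult_notin)
    then have "?X \<in> ?A" by blast
    moreover have "M \<subseteq> ?X" unfolding u(2) using subspace_scale[OF L] by (auto simp flip: scale_scale)
    ultimately have "?X = M" by (rule M(2)[rule_format])
    moreover have "x \<in> ?X"
      using subspace_scale[OF L v(2), of u] by (simp add: mult.commute)
    ultimately show ?thesis by simp
  qed
  then have "loc_sat scale P L = {x. u *s x \<in> L}" unfolding loc_sat_def using u by blast
  then show thesis using that u(1) by blast
qed

lemma subspace_loc_sat: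
  assumes "prime_ideal P" "subspace L"
  shows "subspace (loc_sat scale P L)"
  by (rule loc_sat_uniform[OF assms]) (simp add: subspace_preimage_scale[OF assms(2)])

section \<open>Associated primes and support\<close>

text \<open>A colon prime modulo the saturation becomes a colon prime modulo \<open>L\<close> once
  \<open>y\<close> is multiplied by the uniform denominator. It lies in \<open>P\<close> because
  elements outside \<open>P\<close> cancel modulo the saturation.\<close>

lemma Ass_quot_below:
  assumes P: "prime_ideal P" and L: "subspace L" and x: "x \<notin> loc_sat scale P L"
  obtains p where "p \<in> Ass_quot scale L" "p \<subseteq> P"
proof -
  obtain u where u: "u \<notin> P" "loc_sat scale P L = {x. u *s x \<in> L}"
    by (rule loc_sat_uniform[OF P L])
  have "\<not> UNIV \<subseteq> loc_sat scale P L" using x by blast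
  then obtain y where y: "y \<notin> loc_sat scale P L" "prime_ideal {r. r *s y \<in> loc_sat scale P L}"
    by (rule colon_prime_exists[OF subspace_loc_sat[OF P L] subspace_UNIV])
  let ?p = "{r. r *s y \<in> loc_sat scale P L}"
  have "?p = {r. r *s (u *s y) \<in> L}" unfolding u(2) by (simp add: mult.commute)
  then have "?p \<in> Ass_quot scale L" unfolding Ass_quot_def using y(2) by blast
  moreover have "?p \<subseteq> P" using loc_sat_cancel[OF P] y(1) by blast
  ultimately show thesis by (rule that)
qed

text \<open>The core of Nakayama's argument: a relation \<open>u x - r c x \<in> L\<close> has the
  coefficient \<open>u - r c\<close>, which is outside \<open>P\<close> and so is invertible at
  \<open>P\<close>.\<close>

lemma loc_sat_span_insert_scale:
  assumes P: "prime_ideal P" and L: "subspace L" and "c \<in> P"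
    and x: "x \<in> loc_sat scale P (span (insert (c *s x) L))"
  shows "x \<in> loc_sat scale P L"
proof -
  obtain u where u: "u \<notin> P" "u *s x \<in> span (insert (c *s x) L)"
    using x unfolding loc_sat_def by blast
  then obtain r where "u *s x - r *s c *s x \<in> span L" using span_breakdown_eq by blast
  then have "(u - r * c) *s x \<in> L"
    using L by (simp add: scale_left_diff_distrib span_eq_iff[THEN iffD2])
  moreover have "u - r * c \<notin> P"
    using prime_ideal_diff_notin[OF P u(1)] assms(3) prime_ideal_mult_iff[OF P] by blast
  ultimately show ?thesis unfolding loc_sat_def by blast
qed

text \<open>Nakayama's lemma: a submodule maximal among those whose localisation at \<open>P\<close> is proper
  has a localisation of colength one, hence contains \<open>PN\<close>.\<close>

lemma Supp_imp_pow_submod_not_dense: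
  assumes "P \<in> Supp scale" "I \<subseteq> P"
  obtains x where "x \<notin> loc_sat scale P (pow_submod scale I 1)"
proof -
  obtain x0 where P: "prime_ideal P" and x0: "{r. r *s x0 = 0} \<subseteq> P"
    using assms(1) unfolding Supp_def by blast
  let ?A = "{L. subspace L \<and> loc_sat scale P L \<noteq> UNIV}"
  have "x0 \<notin> loc_sat scale P {0}" using x0 unfolding loc_sat_def by blast
  then have "{0} \<in> ?A" using subspace_single_0 by blast
  then have "?A \<noteq> {}" by blast
  then obtain L where L: "L \<in> ?A" "\<forall>X\<in>?A. L \<subseteq> X \<longrightarrow> X = L"
    by (rule maximal_subspace) blast
  \<comment> \<open>The saturation of \<open>L\<close> belongs to the same family by idempotence, so
    maximality makes \<open>L\<close> saturated.\<close>
  have sL: "subspace L" and "loc_sat scale P L \<in> ?A"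
    using L(1) subspace_loc_sat[OF P] loc_sat_idem[OF P] by auto
  then have sat: "loc_sat scale P L = L" using L(2) loc_sat_superset[OF P] by blast
  have "c *s x \<in> L" if c: "c \<in> I" for c x
  proof (rule ccontr)
    assume cx: "c *s x \<notin> L"
    let ?X = "span (insert (c *s x) L)"
    have "L \<subseteq> ?X" "c *s x \<in> ?X" by (auto intro: span_base)
    then have "?X \<notin> ?A" using L(2) cx by blast
    then have "x \<in> loc_sat scale P ?X" using subspace_span by blast
    then have "x \<in> L" using loc_sat_span_insert_scale[OF P sL] assms(2) c sat by blast
    then show False using cx subspace_scale[OF sL] by blast
  qed
  then have "loc_sat scale P (pow_submod scale I 1) \<subseteq> loc_sat scale P L"
    by (intro loc_sat_mono pow_submod_1_subset[OF sL])
  then show thesis using that L(1) by blast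
qed

lemma Ass_quot_pow_submod_below:
  assumes "P \<in> Supp scale" "I \<subseteq> P"
  obtains p where "p \<in> Ass_quot scale (pow_submod scale I 1)" "p \<subseteq> P"
proof -
  have "prime_ideal P" using assms(1) unfolding Supp_def by blast
  moreover obtain x where "x \<notin> loc_sat scale P (pow_submod scale I 1)"
    by (rule Supp_imp_pow_submod_not_dense[OF assms])
  ultimately show thesis by (rule Ass_quot_below[OF _ subspace_pow_submod _ that])
qed

lemma Ass_quot_contains:
  assumes "p \<in> Ass_quot scale (pow_submod scale I (Suc n))"
  shows "I \<subseteq> p"
proof
  fix r assume "r \<in> I"
  obtain x where x: "prime_ideal p" "p = {r. r *s x \<in> pow_submod scale I (Suc n)}"
    using assms unfolding Ass_quot_def by blast
  have "r ^ Suc n \<in> p"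
    unfolding x(2) mem_Collect_eq
    by (rule scale_in_pow_submod[OF power_in_ideal_pow[OF \<open>r \<in> I\<close>]])
  then show "r \<in> p" by (rule prime_ideal_power[OF x(1)])
qed

lemma Ass_quot_in_Supp:
  assumes "p \<in> Ass_quot scale L" "subspace L"
  shows "p \<in> Supp scale"
proof -
  obtain x where x: "prime_ideal p" "p = {r. r *s x \<in> L}" using assms(1) unfolding Ass_quot_def by blast
  then have "{r. r *s x = 0} \<subseteq> p" using subspace_0[OF assms(2)] by auto
  then show ?thesis unfolding Supp_def using x(1) by blast
qed

section \<open>Fitting's decomposition and Krull's intersection theorem\<close>

text \<open>Take \<open>m\<close> where the chain of submodules \<open>(L : r^j)\<close> with
  \<open>j > 0\<close> has stabilised, and \<open>A = r^m N + L\<close>. An element of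
  \<open>A \<inter> B\<close> is \<open>r^m y\<close> modulo \<open>L\<close> with
  \<open>r^(2m) y \<in> L\<close>, and stability gives \<open>r^m y \<in> L\<close>. Positivity of
  \<open>m\<close> ensures that \<open>r x \<in> L\<close> implies \<open>x \<in> B\<close>.\<close>

lemma Fitting_decomposition:
  assumes L: "subspace L"
  obtains m A B where "m > 0" "subspace A" "subspace B" "A \<inter> B = L"
    "range (scale (r ^ m)) \<subseteq> A" "B = {x. r ^ m *s x \<in> L}"
proof -
  let ?A = "range (\<lambda>j. {x. r ^ Suc j *s x \<in> L})"
  have "?A \<noteq> {}" by blast
  moreover have "subspace X" if "X \<in> ?A" for X using that subspace_preimage_scale[OF L] by blast
  ultimately obtain B where B: "B \<in> ?A" "\<forall>X\<in>?A. B \<subseteq> X \<longrightarrow> X = B"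
    by (rule maximal_subspace)
  then obtain j where j: "B = {x. r ^ Suc j *s x \<in> L}" by blast
  define m where "m = Suc j"
  let ?X = "{x. r ^ (m + m) *s x \<in> L}"
  have "?X \<in> ?A" by (rule range_eqI[of _ _ "j + m"]) (simp add: m_def)
  moreover have "B \<subseteq> ?X" unfolding j m_def[symmetric] power_add
    using subspace_scale[OF L] by (auto simp flip: scale_scale)
  ultimately have stable: "?X = B" by (rule B(2)[rule_format])
  let ?S = "{z. \<exists>y. z - r ^ m *s y \<in> L}"
  have "subspace ?S" by (rule subspace_plus_range_scale[OF L])
  moreover have "subspace B" using subspace_preimage_scale[OF L] j by blast
  moreover have "?S \<inter> B = L"
  proof
    show "?S \<inter> B \<subseteq> L"
    proof
      fix z assume "z \<in> ?S \<inter> B"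
      then obtain y where z: "z - r ^ m *s y \<in> L" "r ^ m *s z \<in> L"
        unfolding j m_def by blast
      have "r ^ m *s z - r ^ m *s (z - r ^ m *s y) \<in> L"
        using subspace_diff[OF L z(2) subspace_scale[OF L z(1)]] .
      then have "y \<in> ?X" by (simp add: scale_right_diff_distrib power_add)
      then have "r ^ m *s y \<in> L" using stable j m_def by blast
      then show "z \<in> L" using subspace_add[OF L z(1)] by fastforce
    qed
    have "x \<in> ?S" if "x \<in> L" for x
    proof -
      have "x - r ^ m *s 0 \<in> L" using that by simp
      then show ?thesis by blast
    qed
    then show "L \<subseteq> ?S \<inter> B" unfolding j using subspace_scale[OF L] by blast
  qed
  moreover have "range (scale (r ^ m)) \<subseteq> ?S"
  proof clarify
    fix y
    have "r ^ m *s y - r ^ m *s y \<in> L" using subspace_0[OF L] by simp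
    then show "\<exists>y'. r ^ m *s y - r ^ m *s y' \<in> L" by blast
  qed
  ultimately show thesis using that[of m ?S B] j by (simp add: m_def)
qed

text \<open>The submodules \<open>(L : I^n)\<close> stabilise at some \<open>B\<close>. If
  \<open>B\<close> were proper, some \<open>y \<notin> B\<close> would have a prime colon ideal,
  which contains \<open>I\<close> by nilpotence; then \<open>I^(n+1) y \<subseteq> L\<close>, and
  stability would put \<open>y\<close> into \<open>B\<close>.\<close>

lemma nilpotent_imp_pow_submod_subset:
  assumes L: "subspace L" and nil: "\<And>c. c \<in> I \<Longrightarrow> \<exists>j. \<forall>y. c ^ j *s y \<in> L"
  obtains n where "pow_submod scale I n \<subseteq> L"
proof -
  let ?B = "\<lambda>n. {y. \<forall>r\<in>ideal_pow I n. r *s y \<in> L}"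
  have sub: "subspace (?B n)" for n
  proof -
    have "?B n = (\<Inter>r\<in>ideal_pow I n. {y. r *s y \<in> L})" by blast
    then show ?thesis using subspace_preimage_scale[OF L] by (auto intro!: subspace_Inter)
  qed
  have "range ?B \<noteq> {}" by blast
  moreover have "subspace X" if "X \<in> range ?B" for X using that sub by blast
  ultimately obtain B where B: "B \<in> range ?B" "\<forall>X\<in>range ?B. B \<subseteq> X \<longrightarrow> X = B"
    by (rule maximal_subspace)
  then obtain n where n: "B = ?B n" by blast
  have LB: "L \<subseteq> B" unfolding n using subspace_scale[OF L] by blast
  have "UNIV \<subseteq> B"
  proof (rule ccontr)
    assume "\<not> UNIV \<subseteq> B"
    then obtain y where y: "y \<notin> B" "prime_ideal {r. r *s y \<in> B}"
      by (rule colon_prime_exists[OF sub[of n, folded n] subspace_UNIV])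
    have Iy: "c *s y \<in> B" if c: "c \<in> I" for c
    proof -
      obtain j where "c ^ j *s y \<in> L" using nil[OF c] by blast
      then have "c ^ j \<in> {r. r *s y \<in> B}" using LB by blast
      then show ?thesis using prime_ideal_power[OF y(2)] by blast
    qed
    have "ideal_pow I (Suc n) \<subseteq> {r. r *s y \<in> L}"
    proof (rule ideal_pow_Suc_subset[OF is_ideal_colon[OF L]])
      fix a c assume "a \<in> I" "c \<in> ideal_pow I n"
      then have "c *s a *s y \<in> L" using Iy n by blast
      then show "a * c \<in> {r. r *s y \<in> L}" by (simp add: mult.commute)
    qed
    then have "y \<in> ?B (Suc n)" by blast
    moreover have "B \<subseteq> ?B (Suc n)"
      using ideal_pow_add_subset[of I n 1] unfolding n by auto
    then have "?B (Suc n) = B" using B(2) by blast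
    ultimately show False using y(1) by blast
  qed
  then have "pow_submod scale I n \<subseteq> L" unfolding pow_submod_subset_iff[OF L] n by blast
  then show thesis by (rule that)
qed

text \<open>Fitting's decomposition shows that every element of \<open>P\<close> acts nilpotently modulo a submodule
  maximal among those whose localisation at \<open>P\<close> misses \<open>x\<close>.\<close>

lemma Krull_intersection_local:
  assumes P: "prime_ideal P" and I: "I \<subseteq> P" and x: "\<And>n. x \<in> pow_submod scale I n"
  shows "x \<in> loc_sat scale P {0}"
proof (rule ccontr)
  assume "x \<notin> loc_sat scale P {0}"
  let ?A = "{L. subspace L \<and> x \<notin> loc_sat scale P L}"
  have "{0} \<in> ?A" using subspace_single_0 \<open>x \<notin> loc_sat scale P {0}\<close> by blast
  then have "?A \<noteq> {}" by blast
  then obtain L where L: "L \<in> ?A" "\<forall>X\<in>?A. L \<subseteq> X \<longrightarrow> X = L"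
    by (rule maximal_subspace) blast
  have sL: "subspace L" and xL: "x \<notin> loc_sat scale P L" using L(1) by auto
  have larger: "x \<in> loc_sat scale P X" if "subspace X" "L \<subseteq> X" "X \<noteq> L" for X
    using L(2) that by blast
  have "\<exists>j. \<forall>y. c ^ j *s y \<in> L" if c: "c \<in> I" for c
  proof -
    obtain m A B where AB: "m > 0" "subspace A" "subspace B" "A \<inter> B = L"
      "range (scale (c ^ m)) \<subseteq> A" "B = {x. c ^ m *s x \<in> L}"
      by (rule Fitting_decomposition[OF sL])
    have "A = L"
    proof (rule ccontr)
      assume "A \<noteq> L"
      then have "x \<in> loc_sat scale P A" using larger AB by blast
      then obtain u where u: "u \<notin> P" "u *s x \<in> A" unfolding loc_sat_def by blast
      show False
      proof (cases "B = L")
        case True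
        \<comment> \<open>Here \<open>c\<close> acts injectively modulo \<open>L\<close>, so
          adjoining \<open>c *s x\<close> strictly enlarges \<open>L\<close>. Maximality puts
          \<open>x\<close> into the enlarged submodule at \<open>P\<close>, and Nakayama's argument
          brings it back into \<open>L\<close> at \<open>P\<close>.\<close>
        let ?X = "span (insert (c *s x) L)"
        have X: "L \<subseteq> ?X" "c *s x \<in> ?X" by (auto intro: span_base)
        have "x \<notin> L" using xL loc_sat_superset[OF P] by blast
        then have "c ^ m *s x \<notin> L" using True AB(6) by blast
        moreover obtain k where "m = Suc k" using AB(1) gr0_conv_Suc by blast
        then have "c ^ m *s x = c ^ k *s c *s x" by (simp add: mult.commute)
        ultimately have "c *s x \<notin> L" using subspace_scale[OF sL] by metis
        then have "?X \<noteq> L" using X(2) by blast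
        then have "x \<in> loc_sat scale P ?X" by (rule larger[OF subspace_span X(1)])
        then show False using loc_sat_span_insert_scale[OF P sL] I c xL by blast
      next
        case False
        \<comment> \<open>Both factors are now strictly larger than \<open>L\<close>, so
          \<open>x\<close> lies in each of them at \<open>P\<close>; the product of the two
          denominators sends \<open>x\<close> into \<open>A \<inter> B = L\<close>.\<close>
        then have "x \<in> loc_sat scale P B" using larger AB(3,4) by blast
        then obtain v where v: "v \<notin> P" "v *s x \<in> B" unfolding loc_sat_def by blast
        have "(u * v) *s x \<in> B" using subspace_scale[OF AB(3) v(2)] by simp
        moreover have "(u * v) *s x \<in> A"
          using subspace_scale[OF AB(2) u(2), of v] by (simp add: mult.commute)
        ultimately have "(u * v) *s x \<in> L" using AB(4) by blast
        then show False using xL prime_ideal_mult_notin[OF P u(1) v(1)] unfolding loc_sat_def by blast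
      qed
    qed
    then show ?thesis using AB(5) by blast
  qed
  then obtain n where "pow_submod scale I n \<subseteq> L" by (rule nilpotent_imp_pow_submod_subset[OF sL])
  then have "x \<in> L" using x by blast
  then show False using xL loc_sat_superset[OF P] by blast
qed

section \<open>Minimal primary decompositions and symbolic powers\<close>

text \<open>Noetherian induction: a maximal counterexample is not primary, and Fitting's
  decomposition for an element violating primariness splits it into two strictly larger
  submodules.\<close>

lemma primary_dec_exists:
  assumes "subspace L"
  shows "\<exists>D. finite D \<and> (\<forall>Q\<in>D. primary_submod scale Q) \<and> \<Inter>D = L" (is "?dec L")
proof (rule ccontr)
  assume "\<not> ?dec L"
  let ?A = "{L. subspace L \<and> \<not> ?dec L}"
  have "L \<in> ?A" using assms \<open>\<not> ?dec L\<close> by blast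
  then have "?A \<noteq> {}" by blast
  then obtain M where M: "M \<in> ?A" "\<forall>X\<in>?A. M \<subseteq> X \<longrightarrow> X = M"
    by (rule maximal_subspace) blast
  have sM: "subspace M" and nd: "\<not> ?dec M" using M(1) by auto
  \<comment> \<open>The whole module is the intersection of the empty family.\<close>
  have "?dec UNIV" by (rule exI[of _ "{}"]) simp
  then have "M \<noteq> UNIV" using nd by blast
  moreover have "\<not> primary_submod scale M"
  proof
    assume "primary_submod scale M"
    then have "?dec M" by (intro exI[of _ "{M}"]) simp
    then show False using nd by blast
  qed
  ultimately obtain r x where rx: "r *s x \<in> M" "x \<notin> M" "\<And>n. \<exists>y. r ^ n *s y \<notin> M"
    using sM unfolding primary_submod_def by blast
  obtain m A B where AB: "m > 0" "subspace A" "subspace B" "A \<inter> B = M"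
      "range (scale (r ^ m)) \<subseteq> A" "B = {x. r ^ m *s x \<in> M}"
    by (rule Fitting_decomposition[OF sM])
  have "A \<noteq> M" using rx(3)[of m] AB(5) by blast
  then obtain D1 where D1: "finite D1" "\<forall>Q\<in>D1. primary_submod scale Q" "\<Inter>D1 = A"
    using M(2) AB(2,4) by blast
  obtain k where "m = Suc k" using AB(1) gr0_conv_Suc by blast
  then have "r ^ m *s x = r ^ k *s r *s x" by (simp add: mult.commute)
  then have "x \<in> B" using AB(6) subspace_scale[OF sM rx(1)] by simp
  then have "B \<noteq> M" using rx(2) by blast
  then obtain D2 where D2: "finite D2" "\<forall>Q\<in>D2. primary_submod scale Q" "\<Inter>D2 = B"
    using M(2) AB(3,4) by blast
  have "\<Inter>(D1 \<union> D2) = M" using D1(3) D2(3) AB(4) by auto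
  then have "?dec M" using D1(1,2) D2(1,2) by (intro exI[of _ "D1 \<union> D2"]) auto
  then show False using nd by blast
qed

lemma scale_power_mono:
  assumes "subspace Q" "\<forall>y. r ^ n *s y \<in> Q" "n \<le> m"
  shows "r ^ m *s y \<in> Q"
proof -
  have "r ^ m = r ^ n * r ^ (m - n)" using assms(3) by (simp flip: power_add)
  then show ?thesis using assms(2) by (simp flip: scale_scale)
qed

lemma primary_prime_inter:
  assumes "subspace Q1" "subspace Q2"
  shows "primary_prime scale (Q1 \<inter> Q2) = primary_prime scale Q1 \<inter> primary_prime scale Q2"
proof
  show "primary_prime scale Q1 \<inter> primary_prime scale Q2 \<subseteq> primary_prime scale (Q1 \<inter> Q2)"
  proof
    fix r assume "r \<in> primary_prime scale Q1 \<inter> primary_prime scale Q2"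
    then obtain n m where "\<forall>y. r ^ n *s y \<in> Q1" "\<forall>y. r ^ m *s y \<in> Q2"
      unfolding primary_prime_def by blast
    then have "\<forall>y. r ^ (n + m) *s y \<in> Q1 \<inter> Q2"
      using scale_power_mono[OF assms(1), of r n "n + m"] scale_power_mono[OF assms(2), of r m "n + m"]
      by auto
    then show "r \<in> primary_prime scale (Q1 \<inter> Q2)" unfolding primary_prime_def by blast
  qed
qed (auto simp: primary_prime_def)

lemma primary_submod_inter:
  assumes Q: "primary_submod scale Q1" "primary_submod scale Q2"
    and eq: "primary_prime scale Q1 = primary_prime scale Q2"
  shows "primary_submod scale (Q1 \<inter> Q2)"
proof -
  have sub: "subspace Q1" "subspace Q2" using Q unfolding primary_submod_def by auto
  have p: "primary_prime scale (Q1 \<inter> Q2) = primary_prime scale Q1"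
    "primary_prime scale (Q1 \<inter> Q2) = primary_prime scale Q2"
    using primary_prime_inter[OF sub] eq by auto
  have "r \<in> primary_prime scale (Q1 \<inter> Q2)" if rx: "r *s x \<in> Q1 \<inter> Q2" "x \<notin> Q1 \<inter> Q2" for r x
  proof (cases "x \<in> Q1")
    case True
    then have "r \<in> primary_prime scale Q2" using rx Q(2) unfolding primary_submod_def primary_prime_def by blast
    then show ?thesis using p by simp
  next
    case False
    then have "r \<in> primary_prime scale Q1" using rx Q(1) unfolding primary_submod_def primary_prime_def by blast
    then show ?thesis using p by simp
  qed
  moreover have "Q1 \<inter> Q2 \<noteq> UNIV" using Q(1) unfolding primary_submod_def by blast
  ultimately show ?thesis
    unfolding primary_submod_def using subspace_inter[OF sub] unfolding primary_prime_def by blast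
qed

text \<open>A primary decomposition of least cardinality is minimal: a redundant component could be
  dropped, and two components with the same prime could be replaced by their intersection.\<close>

lemma min_primary_dec_exists:
  assumes "subspace L"
  shows "\<exists>D. min_primary_dec scale L D"
proof -
  let ?dec = "\<lambda>D. finite D \<and> (\<forall>Q\<in>D. primary_submod scale Q) \<and> \<Inter>D = L"
  obtain D0 where D0: "?dec D0" using primary_dec_exists[OF assms] by blast
  define D where "D = arg_min card ?dec"
  have D: "?dec D" unfolding D_def by (rule arg_min_natI[of ?dec, OF D0])
  have min: "card D \<le> card E" if "?dec E" for E
    unfolding D_def by (rule arg_min_nat_le[of ?dec, OF that])
  have "\<Inter>(D - {Q}) \<noteq> L" if "Q \<in> D" for Q
  proof
    assume "\<Inter>(D - {Q}) = L"
    then have "card D \<le> card (D - {Q})" using D by (intro min) auto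
    then show False using card_Diff1_less[of D Q] D that by auto
  qed
  moreover have "inj_on (primary_prime scale) D"
  proof (rule inj_onI, rule ccontr)
    fix Q1 Q2 assume Q: "Q1 \<in> D" "Q2 \<in> D" "primary_prime scale Q1 = primary_prime scale Q2" "Q1 \<noteq> Q2"
    let ?E = "insert (Q1 \<inter> Q2) (D - {Q1, Q2})"
    have "primary_submod scale (Q1 \<inter> Q2)" using primary_submod_inter Q D by blast
    moreover have "\<Inter>?E = \<Inter>D" using Q by blast
    ultimately have "?dec ?E" using D by auto
    then have "card D \<le> card ?E" by (rule min)
    also have "\<dots> \<le> Suc (card (D - {Q1, Q2}))" using D by (intro card_insert_le_m1) auto
    also have "card (D - {Q1, Q2}) = card D - 2"
      using card_Diff_subset[of "{Q1, Q2}" D] Q by auto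
    finally have "card D \<le> Suc (card D - 2)" .
    \<comment> \<open>This rules out truncation in \<open>card D - 2\<close>, so the previous
      inequality is absurd.\<close>
    moreover have "2 \<le> card D" using card_mono[of D "{Q1, Q2}"] Q D by auto
    ultimately show False by simp
  qed
  ultimately have "min_primary_dec scale L D" unfolding min_primary_dec_def using D by blast
  then show ?thesis by blast
qed

text \<open>Resolves the choice in \<open>symb_power\<close>. Later arguments work with whichever
  minimal decomposition has been chosen.\<close>

lemma symb_power_dec:
  obtains D where "min_primary_dec scale (pow_submod scale I n) D"
    "symb_power scale I n = \<Inter>{Q \<in> D. primary_prime scale Q \<in> min_Ass_quot scale (pow_submod scale I 1)}"
proof
  show "min_primary_dec scale (pow_submod scale I n) (SOME D. min_primary_dec scale (pow_submod scale I n) D)"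
    using min_primary_dec_exists[OF subspace_pow_submod] by (rule someI_ex)
qed (simp add: symb_power_def Let_def)

lemma symb_powerI:
  assumes "\<And>Q. primary_submod scale Q \<Longrightarrow> pow_submod scale I n \<subseteq> Q \<Longrightarrow>
    primary_prime scale Q \<in> min_Ass_quot scale (pow_submod scale I 1) \<Longrightarrow> x \<in> Q"
  shows "x \<in> symb_power scale I n"
proof (rule symb_power_dec[of I n])
  fix D
  assume D: "min_primary_dec scale (pow_submod scale I n) D"
    and eq: "symb_power scale I n = \<Inter>{Q \<in> D. primary_prime scale Q \<in> min_Ass_quot scale (pow_submod scale I 1)}"
  have "primary_submod scale Q" "pow_submod scale I n \<subseteq> Q" if "Q \<in> D" for Q
    using D that unfolding min_primary_dec_def by auto
  then show ?thesis unfolding eq using assms by blast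
qed

lemma primary_submod_cancel:
  assumes "primary_submod scale Q" "r *s x \<in> Q" "r \<notin> primary_prime scale Q"
  shows "x \<in> Q"
  using assms unfolding primary_submod_def primary_prime_def by blast

text \<open>By irredundance the intersection of the other components is not contained in
  \<open>L\<close>, so it contains some \<open>y \<notin> L\<close> with a prime colon ideal. For
  this \<open>y\<close> the colon ideals into \<open>L\<close> and into \<open>Q\<close> agree, and
  primariness identifies them with the prime of \<open>Q\<close>.\<close>

lemma primary_prime_in_Ass_quot:
  assumes D: "min_primary_dec scale L D" and Q: "Q \<in> D"
  shows "primary_prime scale Q \<in> Ass_quot scale L"
proof -
  let ?L' = "\<Inter>(D - {Q})"
  have sub: "subspace Q'" if "Q' \<in> D" for Q'
    using D that unfolding min_primary_dec_def primary_submod_def by blast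
  have L: "\<Inter>D = L" using D unfolding min_primary_dec_def by blast
  have sL: "subspace L" unfolding L[symmetric] using sub by (rule subspace_Inter[OF ballI])
  have sL': "subspace ?L'" using sub by (intro subspace_Inter) blast
  have inter: "?L' \<inter> Q = L" using L Q by blast
  have "?L' \<noteq> L" using D Q unfolding min_primary_dec_def by blast
  then have "\<not> ?L' \<subseteq> L" using inter by blast
  then obtain y where y: "y \<in> ?L'" "y \<notin> L" "prime_ideal {r. r *s y \<in> L}"
    by (rule colon_prime_exists[OF sL sL'])
  have mem: "r *s y \<in> L \<longleftrightarrow> r *s y \<in> Q" for r using inter subspace_scale[OF sL' y(1)] by blast
  have pQ: "primary_submod scale Q" using D Q unfolding min_primary_dec_def by blast
  have "y \<notin> Q" using inter y by blast
  have "primary_prime scale Q = {r. r *s y \<in> L}"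
  proof (intro equalityI subsetI)
    fix r assume "r \<in> primary_prime scale Q"
    then obtain n where "r ^ n *s y \<in> Q" unfolding primary_prime_def by blast
    then have "r ^ n \<in> {r. r *s y \<in> L}" using mem by blast
    then show "r \<in> {r. r *s y \<in> L}" by (rule prime_ideal_power[OF y(3)])
  next
    fix r assume "r \<in> {r. r *s y \<in> L}"
    then show "r \<in> primary_prime scale Q" using primary_submod_cancel[OF pQ] mem \<open>y \<notin> Q\<close> by blast
  qed
  then show ?thesis unfolding Ass_quot_def using y(3) by auto
qed

text \<open>Each component whose prime is not inside \<open>P\<close> becomes everything at
  \<open>P\<close>; the product of one denominator per component witnesses this for all of them at
  once.\<close>

lemma dec_components_away_from_prime:
  assumes D: "min_primary_dec scale L D" and P: "prime_ideal P"
  obtains u where "u \<notin> P" "\<And>Q y. Q \<in> D \<Longrightarrow> \<not> primary_prime scale Q \<subseteq> P \<Longrightarrow> u *s y \<in> Q"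
proof -
  let ?E = "{Q \<in> D. \<not> primary_prime scale Q \<subseteq> P}"
  have fin: "finite ?E" using D unfolding min_primary_dec_def by simp
  have "\<forall>Q\<in>?E. \<exists>v. v \<notin> P \<and> (\<forall>y. v *s y \<in> Q)"
  proof
    fix Q assume "Q \<in> ?E"
    then obtain r n where "r \<notin> P" "\<forall>y. r ^ n *s y \<in> Q" unfolding primary_prime_def by blast
    then show "\<exists>v. v \<notin> P \<and> (\<forall>y. v *s y \<in> Q)" using prime_ideal_power[OF P] by blast
  qed
  then obtain v where "\<forall>Q\<in>?E. v Q \<notin> P \<and> (\<forall>y. v Q *s y \<in> Q)" by (rule bchoice[THEN exE])
  then have v: "\<And>Q. Q \<in> ?E \<Longrightarrow> v Q \<notin> P" "\<And>Q y. Q \<in> ?E \<Longrightarrow> v Q *s y \<in> Q" by blast+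
  have "prod v ?E *s y \<in> Q" if Q: "Q \<in> ?E" for Q y
  proof -
    have "prod v ?E = v Q * prod v (?E - {Q})" by (rule prod.remove[OF fin Q])
    then show ?thesis using v(2)[OF Q] by (simp flip: scale_scale)
  qed
  moreover have "prod v ?E \<notin> P" by (rule prime_ideal_prod_notin[OF P fin v(1)])
  ultimately show thesis using that[of "prod v ?E"] by blast
qed

section \<open>Associated primes of localisations and minimal primes of the support\<close>

text \<open>The uniform denominator turns an annihilator in \<open>N_P\<close> into the annihilator
  of an element of \<open>N\<close>. Conversely, elements outside \<open>P\<close> are outside every
  smaller prime and cancel there.\<close>

lemma loc_Ass_eq:
  assumes P: "prime_ideal P"
  shows "loc_Ass scale P = {p \<in> Ass_quot scale {0}. p \<subseteq> P}"
proof (intro equalityI subsetI)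
  fix p assume "p \<in> loc_Ass scale P"
  then obtain x where p: "prime_ideal p" "p \<subseteq> P" "p = {r. r *s x \<in> loc_sat scale P {0}}"
    unfolding loc_Ass_def loc_sat_def by auto
  obtain u where u: "u \<notin> P" "loc_sat scale P {0} = {x. u *s x \<in> {0}}"
    by (rule loc_sat_uniform[OF P subspace_single_0])
  have "p = {r. r *s u *s x \<in> {0}}" unfolding p(3) u(2) by (simp add: mult.commute)
  then show "p \<in> {p \<in> Ass_quot scale {0}. p \<subseteq> P}" using p(1,2) unfolding Ass_quot_def by blast
next
  fix p assume "p \<in> {p \<in> Ass_quot scale {0}. p \<subseteq> P}"
  then obtain x where p: "prime_ideal p" "p \<subseteq> P" "p = {r. r *s x \<in> {0}}"
    unfolding Ass_quot_def by blast
  have "(\<exists>u. u \<notin> P \<and> (u * r) *s x = 0) \<longleftrightarrow> r \<in> p" for r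
  proof
    assume "\<exists>u. u \<notin> P \<and> (u * r) *s x = 0"
    then obtain u where "u \<notin> p" "u * r \<in> p" using p(2,3) by blast
    then show "r \<in> p" using prime_ideal_mult_iff[OF p(1)] by blast
  next
    assume "r \<in> p"
    then have "(1 * r) *s x = 0" using p(3) by simp
    then show "\<exists>u. u \<notin> P \<and> (u * r) *s x = 0" using prime_ideal_one[OF P] by blast
  qed
  then show "p \<in> loc_Ass scale P" unfolding loc_Ass_def using p(1,2) by blast
qed

lemma Supp_Ass_below:
  assumes "P \<in> Supp scale"
  obtains p where "p \<in> Ass_quot scale {0}" "p \<subseteq> P"
proof -
  obtain x where x: "prime_ideal P" "{r. r *s x = 0} \<subseteq> P" using assms unfolding Supp_def by blast
  then have "x \<notin> loc_sat scale P {0}" unfolding loc_sat_def by blast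
  then show thesis by (rule Ass_quot_below[OF x(1) subspace_single_0 _ that])
qed

lemma Supp_prime: "P \<in> Supp scale \<Longrightarrow> prime_ideal P"
  unfolding Supp_def by blast

lemma Supp_minimal_below:
  assumes P: "P \<in> Supp scale"
  obtains q where "q \<in> Ass_quot scale {0}" "q \<subseteq> P" "\<And>p. p \<in> Supp scale \<Longrightarrow> p \<subseteq> q \<Longrightarrow> p = q"
proof -
  obtain D where D: "min_primary_dec scale {0} D"
    using min_primary_dec_exists[OF subspace_single_0] by blast
  let ?primes = "primary_prime scale ` D"
  \<comment> \<open>Otherwise one \<open>u \<notin> p\<close> would send \<open>N\<close> into every
    component of the zero submodule and so annihilate \<open>N\<close>, contrary to \<open>p\<close>
    being in the support. Minimal primes can thus be sought in a finite set.\<close>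
  have below: "\<exists>q\<in>?primes. q \<subseteq> p" if p: "p \<in> Supp scale" for p
  proof (rule ccontr)
    assume none: "\<not> (\<exists>q\<in>?primes. q \<subseteq> p)"
    obtain u where u: "u \<notin> p" "\<And>Q y. Q \<in> D \<Longrightarrow> \<not> primary_prime scale Q \<subseteq> p \<Longrightarrow> u *s y \<in> Q"
      using dec_components_away_from_prime[OF D Supp_prime[OF p]] by blast
    then have "u *s y \<in> \<Inter>D" for y using none by blast
    then have "u *s y = 0" for y using D unfolding min_primary_dec_def by auto
    then show False using p u(1) unfolding Supp_def by blast
  qed
  let ?B = "{q \<in> ?primes. q \<subseteq> P}"
  have "finite ?B" using D unfolding min_primary_dec_def by auto
  moreover have "?B \<noteq> {}" using below[OF P] by blast
  ultimately obtain q where q: "q \<in> ?B" "\<forall>p\<in>?B. p \<subseteq> q \<longrightarrow> q = p"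
    by (rule finite_has_minimal[THEN bexE])
  have "p = q" if p: "p \<in> Supp scale" "p \<subseteq> q" for p
  proof -
    obtain q' where "q' \<in> ?primes" "q' \<subseteq> p" using below[OF p(1)] by blast
    then show ?thesis using q p(2) by blast
  qed
  moreover have "q \<in> Ass_quot scale {0}" using primary_prime_in_Ass_quot[OF D] q(1) by blast
  ultimately show thesis using that q(1) by blast
qed

lemma proper_if_subset_Supp:
  assumes "P \<in> Supp scale" "I \<subseteq> P"
  shows "N_proper scale I"
proof (rule Supp_imp_pow_submod_not_dense[OF assms])
  fix x assume "x \<notin> loc_sat scale P (pow_submod scale I 1)"
  then have "x \<notin> pow_submod scale I 1" using loc_sat_superset[OF Supp_prime[OF assms(1)]] by blast
  then show ?thesis unfolding N_proper_def by blast
qed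

section \<open>From linear equivalence to the conditions on dimension and associated primes\<close>

lemma loc_Ass_singleton:
  assumes lin: "\<And>I. is_ideal I \<Longrightarrow> N_proper scale I \<Longrightarrow> lin_equiv_topologies scale I"
    and P: "P \<in> Supp scale"
  shows "\<exists>Q. loc_Ass scale P = {Q}"
proof -
  have pP: "prime_ideal P" by (rule Supp_prime[OF P])
  obtain q where q: "q \<in> Ass_quot scale {0}" "q \<subseteq> P" "\<And>p. p \<in> Supp scale \<Longrightarrow> p \<subseteq> q \<Longrightarrow> p = q"
    using Supp_minimal_below[OF P] by blast
  have qS: "q \<in> Supp scale" by (rule Ass_quot_in_Supp[OF q(1) subspace_single_0])
  have "is_ideal q" by (rule prime_ideal_is_ideal[OF Supp_prime[OF qS]])
  then have "lin_equiv_topologies scale q" using lin proper_if_subset_Supp[OF qS] by blast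
  then obtain k where k: "\<And>n. symb_power scale q (n + k) \<subseteq> pow_submod scale q n"
    unfolding lin_equiv_topologies_def by blast
  obtain q1 where q1: "q1 \<in> Ass_quot scale (pow_submod scale q 1)" "q1 \<subseteq> q"
    by (rule Ass_quot_pow_submod_below[OF qS order_refl])
  have above: "q \<subseteq> p" if "p \<in> Ass_quot scale (pow_submod scale q 1)" for p
    using Ass_quot_contains[of p q 0] that by simp
  \<comment> \<open>Since \<open>q1\<close> lies inside \<open>q\<close> and all associated primes
    of \<open>N/qN\<close> contain \<open>q\<close>, the only minimal one is \<open>q\<close>. The
    symbolic powers of \<open>q\<close> are therefore intersections of \<open>q\<close>-primary
    components.\<close>
  have minq: "p = q" if p: "p \<in> min_Ass_quot scale (pow_submod scale q 1)" for p
    using p above q1 unfolding min_Ass_quot_def by blast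
  have "q' = q" if q': "q' \<in> Ass_quot scale {0}" "q' \<subseteq> P" for q'
  proof (rule ccontr)
    assume "q' \<noteq> q"
    then have "\<not> q' \<subseteq> q" using q(3) Ass_quot_in_Supp[OF q'(1) subspace_single_0] by blast
    then obtain s where s: "s \<in> q'" "s \<notin> q" by blast
    obtain x where x: "q' = {r. r *s x \<in> {0}}" using q'(1) unfolding Ass_quot_def by blast
    \<comment> \<open>The element \<open>s\<close> annihilates \<open>x\<close> and lies outside
      \<open>q\<close>, so it cancels modulo every such component.\<close>
    have "x \<in> symb_power scale q n" for n
    proof (rule symb_powerI)
      fix Q assume Q: "primary_submod scale Q"
        "primary_prime scale Q \<in> min_Ass_quot scale (pow_submod scale q 1)"
      have "subspace Q" using Q(1) unfolding primary_submod_def by blast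
      then have "s *s x \<in> Q" using s(1) x subspace_0 by auto
      then show "x \<in> Q" using primary_submod_cancel[OF Q(1)] minq[OF Q(2)] s(2) by blast
    qed
    then have "x \<in> pow_submod scale q n" for n using k by blast
    then have "x \<in> loc_sat scale P {0}" by (rule Krull_intersection_local[OF pP q(2)])
    then show False using x q'(2) unfolding loc_sat_def by blast
  qed
  then have "loc_Ass scale P = {q}" unfolding loc_Ass_eq[OF pP] using q(1,2) by blast
  then show ?thesis by blast
qed

text \<open>If \<open>a\<close> were a zero divisor on \<open>N_P\<close>, a colon prime of an
  element killed by \<open>a\<close> at \<open>P\<close> would be an associated prime of
  \<open>N_P\<close> containing \<open>a\<close>.\<close>

lemma loc_sat_cancel_nonzerodivisor:
  assumes P: "prime_ideal P" and a: "\<And>p. p \<in> loc_Ass scale P \<Longrightarrow> a \<notin> p"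
    and "a *s y \<in> loc_sat scale P {0}"
  shows "y \<in> loc_sat scale P {0}"
proof (rule ccontr)
  assume "y \<notin> loc_sat scale P {0}"
  let ?K = "loc_sat scale P {0}"
  have K: "subspace ?K" by (rule subspace_loc_sat[OF P subspace_single_0])
  have "\<not> {z. a *s z \<in> ?K} \<subseteq> ?K" using assms(3) \<open>y \<notin> ?K\<close> by blast
  then obtain z where z: "z \<in> {z. a *s z \<in> ?K}" "z \<notin> ?K" "prime_ideal {r. r *s z \<in> ?K}"
    by (rule colon_prime_exists[OF K subspace_preimage_scale[OF K]])
  have "{r. r *s z \<in> ?K} \<subseteq> P" using loc_sat_cancel[OF P] z(2) by blast
  moreover have "{r. r *s z \<in> ?K} = {r. \<exists>u. u \<notin> P \<and> (u * r) *s z = 0}"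
    unfolding loc_sat_def by auto
  ultimately have "{r. r *s z \<in> ?K} \<in> loc_Ass scale P"
    using z(3) unfolding loc_Ass_def by blast
  then show False using a z(1) by blast
qed

text \<open>By induction, every further factor from \<open>a J\<close> contributes one more factor
  \<open>a\<close>.\<close>

lemma ideal_pow_principal_mult:
  "ideal_pow ((*) a ` J) n \<subseteq> (*) (a ^ n) ` ideal_pow J n"
proof (induction n)
  case (Suc n)
  show ?case
  proof (rule ideal_pow_Suc_subset)
    note J = is_ideal_ideal_pow[of J "Suc n"]
    show "is_ideal ((*) (a ^ Suc n) ` ideal_pow J (Suc n))"
    proof (rule is_idealI)
      show "0 \<in> (*) (a ^ Suc n) ` ideal_pow J (Suc n)"
        using J unfolding is_ideal_def by (intro image_eqI[of _ _ 0]) auto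
      show "x + y \<in> (*) (a ^ Suc n) ` ideal_pow J (Suc n)"
        if "x \<in> (*) (a ^ Suc n) ` ideal_pow J (Suc n)" "y \<in> (*) (a ^ Suc n) ` ideal_pow J (Suc n)" for x y
        using that J unfolding is_ideal_def by (auto simp flip: distrib_left simp del: ideal_pow.simps)
      show "r * x \<in> (*) (a ^ Suc n) ` ideal_pow J (Suc n)"
        if "x \<in> (*) (a ^ Suc n) ` ideal_pow J (Suc n)" for r x
        using that J unfolding is_ideal_def
        by (auto simp del: ideal_pow.simps power_Suc simp: mult.left_commute[of r])
    qed
    fix b c assume "b \<in> (*) a ` J" "c \<in> ideal_pow ((*) a ` J) n"
    then obtain b' c' where bc: "b' \<in> J" "b = a * b'" "c' \<in> ideal_pow J n" "c = a ^ n * c'"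
      using Suc by blast
    then have "b' * c' \<in> ideal_pow J (Suc n)" by (intro ideal_pow_SucI)
    moreover have "b * c = a ^ Suc n * (b' * c')" using bc by (simp add: algebra_simps)
    ultimately show "b * c \<in> (*) (a ^ Suc n) ` ideal_pow J (Suc n)" by blast
  qed
qed simp

lemma pow_submod_principal_mult:
  "pow_submod scale ((*) a ` J) n \<subseteq> scale (a ^ n) ` pow_submod scale J n"
proof -
  note J = subspace_pow_submod[of J n]
  have "subspace (scale (a ^ n) ` pow_submod scale J n)"
  proof (rule subspaceI)
    show "0 \<in> scale (a ^ n) ` pow_submod scale J n"
      using subspace_0[OF J] by (intro image_eqI[of _ _ 0]) auto
    show "x + y \<in> scale (a ^ n) ` pow_submod scale J n"
      if "x \<in> scale (a ^ n) ` pow_submod scale J n" "y \<in> scale (a ^ n) ` pow_submod scale J n" for x y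
      using that subspace_add[OF J] by (auto simp flip: scale_right_distrib)
    show "c *s x \<in> scale (a ^ n) ` pow_submod scale J n"
      if "x \<in> scale (a ^ n) ` pow_submod scale J n" for c x
      using that subspace_scale[OF J] by (auto simp only: scale_left_commute[of c])
  qed
  moreover have "r *s y \<in> scale (a ^ n) ` pow_submod scale J n"
    if r: "r \<in> ideal_pow ((*) a ` J) n" for r y
  proof -
    obtain r' where r': "r' \<in> ideal_pow J n" "r = a ^ n * r'"
      using ideal_pow_principal_mult r by blast
    then have "r *s y = a ^ n *s r' *s y" by simp
    then show ?thesis using scale_in_pow_submod[OF r'(1)] by blast
  qed
  ultimately show ?thesis using pow_submod_subset_iff by blast
qed

text \<open>For \<open>a \<in> P1 - P0\<close> the ideal \<open>b = a P2\<close> has \<open>b^n N = a^n P2^n N\<close>, whereas \<open>P2\<close> contributes no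
  minimal component, so the symbolic powers contain \<open>a^n N\<close>. Cancelling \<open>a^n\<close> at \<open>P2\<close> puts \<open>a^k N\<close>
  into every \<open>P2^n N\<close>, against Krull's intersection theorem.\<close>

lemma dim_le_one_if_lin_equiv:
  assumes lin: "\<And>I. is_ideal I \<Longrightarrow> N_proper scale I \<Longrightarrow> lin_equiv_topologies scale I"
  shows "dim_le_one scale"
  unfolding dim_le_one_def
proof (intro notI, elim exE conjE)
  fix P0 P1 P2
  assume S: "P0 \<in> Supp scale" "P1 \<in> Supp scale" "P2 \<in> Supp scale" and lt: "P0 \<subset> P1" "P1 \<subset> P2"
  have P2: "prime_ideal P2" by (rule Supp_prime[OF S(3)])
  obtain a where a: "a \<in> P1" "a \<notin> P0" using lt by blast
  obtain p where p: "p \<in> Ass_quot scale {0}" "p \<subseteq> P0" by (rule Supp_Ass_below[OF S(1)])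
  then have "p \<in> loc_Ass scale P2" unfolding loc_Ass_eq[OF P2] using lt by blast
  \<comment> \<open>The single associated prime at \<open>P2\<close> is \<open>p\<close>, which lies
    inside \<open>P0\<close>; as \<open>a\<close> is outside \<open>P0\<close>, it acts injectively
    on \<open>N\<close> localised at \<open>P2\<close>.\<close>
  then have a_notin: "q \<notin> loc_Ass scale P2 \<or> a \<notin> q" for q
    using loc_Ass_singleton[OF lin S(3)] p(2) a(2) by blast
  define b where "b = (*) a ` P2"
  have iP2: "is_ideal P2" by (rule prime_ideal_is_ideal[OF P2])
  have ib: "is_ideal b"
    unfolding b_def
  proof (rule is_idealI)
    show "0 \<in> (*) a ` P2" using iP2 unfolding is_ideal_def by (intro image_eqI[of _ _ 0]) auto
    show "x + y \<in> (*) a ` P2" if "x \<in> (*) a ` P2" "y \<in> (*) a ` P2" for x y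
      using that iP2 unfolding is_ideal_def by (auto simp flip: distrib_left)
    show "r * x \<in> (*) a ` P2" if "x \<in> (*) a ` P2" for r x
      using that iP2 unfolding is_ideal_def by (auto simp: mult.left_commute[of r])
  qed
  have bP1: "b \<subseteq> P1" unfolding b_def using a(1) prime_ideal_mult_iff[OF Supp_prime[OF S(2)]] by blast
  have "lin_equiv_topologies scale b" by (rule lin[OF ib proper_if_subset_Supp[OF S(2) bP1]])
  then obtain k where k: "\<And>n. symb_power scale b (n + k) \<subseteq> pow_submod scale b n"
    unfolding lin_equiv_topologies_def by blast
  obtain p1 where p1: "p1 \<in> Ass_quot scale (pow_submod scale b 1)" "p1 \<subseteq> P1"
    by (rule Ass_quot_pow_submod_below[OF S(2) bP1])
  have symb: "a ^ n *s y \<in> symb_power scale b n" for n y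
  proof (rule symb_powerI)
    fix Q assume Q: "primary_submod scale Q" "pow_submod scale b n \<subseteq> Q"
      "primary_prime scale Q \<in> min_Ass_quot scale (pow_submod scale b 1)"
    let ?p = "primary_prime scale Q"
    \<comment> \<open>A prime above \<open>P2\<close> strictly contains \<open>p1\<close> and so
      cannot be minimal.\<close>
    have "\<not> P2 \<subseteq> ?p" using Q(3) p1 lt(2) unfolding min_Ass_quot_def by blast
    then obtain s where s: "s \<in> P2" "s \<notin> ?p" by blast
    have "prime_ideal ?p" using Q(3) unfolding min_Ass_quot_def Ass_quot_def by blast
    then have "s ^ n \<notin> ?p" using s(2) prime_ideal_power by blast
    have "(a * s) ^ n *s y \<in> pow_submod scale b n"
      using s(1) by (intro scale_in_pow_submod power_in_ideal_pow) (simp add: b_def)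
    then have "s ^ n *s a ^ n *s y \<in> Q" using Q(2) by (auto simp: power_mult_distrib mult.commute)
    then show "a ^ n *s y \<in> Q" using primary_submod_cancel[OF Q(1)] \<open>s ^ n \<notin> ?p\<close> by blast
  qed
  let ?K = "loc_sat scale P2 {0}"
  obtain u where u: "u \<notin> P2" "?K = {x. u *s x \<in> {0}}"
    by (rule loc_sat_uniform[OF P2 subspace_single_0])
  have cancel: "y \<in> ?K" if "a ^ n *s y \<in> ?K" for n y
    using that
  proof (induction n)
    case 0
    then show ?case by simp
  next
    case (Suc n)
    then have "a *s a ^ n *s y \<in> ?K" by simp
    then show ?case using loc_sat_cancel_nonzerodivisor[OF P2] a_notin Suc.IH by blast
  qed
  have all: "x \<in> ?K" for x
  proof -
    have "u *s a ^ k *s x \<in> pow_submod scale P2 n" for n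
    proof -
      have "a ^ (n + k) *s x \<in> scale (a ^ n) ` pow_submod scale P2 n"
        using symb k pow_submod_principal_mult unfolding b_def by blast
      then obtain y where y: "y \<in> pow_submod scale P2 n" "a ^ (n + k) *s x = a ^ n *s y" by blast
      have "a ^ n *s (a ^ k *s x - y) = 0"
        using y(2) by (simp add: scale_right_diff_distrib power_add)
      moreover have "0 \<in> ?K" using subspace_0[OF subspace_loc_sat[OF P2 subspace_single_0]] .
      ultimately have "a ^ k *s x - y \<in> ?K" using cancel by metis
      \<comment> \<open>Cancelling \<open>a ^ n\<close> gives \<open>a ^ k *s x = y\<close> only
        modulo the kernel \<open>?K\<close>; multiplication by \<open>u\<close>, which kills
        \<open>?K\<close>, makes it an equality in \<open>N\<close>.\<close>
      then have "u *s a ^ k *s x = u *s y" unfolding u(2) by (simp add: scale_right_diff_distrib)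
      then show ?thesis using subspace_scale[OF subspace_pow_submod y(1)] by metis
    qed
    then have "u *s a ^ k *s x \<in> ?K" by (rule Krull_intersection_local[OF P2 order_refl])
    then show ?thesis using loc_sat_cancel[OF P2 u(1)] cancel by blast
  qed
  then show False using S(3) unfolding Supp_def loc_sat_def by blast
qed

section \<open>From the conditions on dimension and associated primes to linear equivalence\<close>

lemma lin_equiv_if_dim_le_one:
  assumes dim: "dim_le_one scale"
    and single: "\<And>P. P \<in> Supp scale \<Longrightarrow> \<exists>Q. loc_Ass scale P = {Q}"
  shows "lin_equiv_topologies scale I"
proof -
  obtain D0 where D0: "min_primary_dec scale {0} D0"
    using min_primary_dec_exists[OF subspace_single_0] by blast
  let ?E = "{Q \<in> D0. I \<subseteq> primary_prime scale Q}"
  have "\<forall>Q\<in>?E. \<exists>n. pow_submod scale I n \<subseteq> Q"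
  proof
    fix Q assume Q: "Q \<in> ?E"
    then have "subspace Q" using D0 unfolding min_primary_dec_def primary_submod_def by blast
    moreover have "\<exists>j. \<forall>y. c ^ j *s y \<in> Q" if "c \<in> I" for c
      using Q that unfolding primary_prime_def by blast
    ultimately show "\<exists>n. pow_submod scale I n \<subseteq> Q"
      by (rule nilpotent_imp_pow_submod_subset) blast+
  qed
  then obtain f where f: "\<forall>Q\<in>?E. pow_submod scale I (f Q) \<subseteq> Q" by (rule bchoice[THEN exE])
  have "finite ?E" using D0 unfolding min_primary_dec_def by simp
  \<comment> \<open>The sum bounds every \<open>f Q\<close>, so one exponent works for all
    components of zero whose prime contains \<open>I\<close>, hence uniformly in \<open>p\<close>
    below.\<close>
  define m where "m = sum f ?E"
  have m: "pow_submod scale I (m + n) \<subseteq> Q" if Q: "Q \<in> ?E" for n Q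
  proof -
    have "f Q \<le> m" unfolding m_def using Q \<open>finite ?E\<close> by (intro member_le_sum) auto
    then have "m + n = f Q + (m - f Q + n)" by simp
    then have "pow_submod scale I (m + n) \<subseteq> pow_submod scale I (f Q)"
      using pow_submod_add_subset by metis
    then show ?thesis using f Q by blast
  qed
  have unmixed: "p \<in> min_Ass_quot scale (pow_submod scale I 1)"
    if p: "p \<in> Ass_quot scale (pow_submod scale I (m + Suc n))" for p n
  proof (rule ccontr)
    assume not_min: "p \<notin> min_Ass_quot scale (pow_submod scale I 1)"
    let ?L = "pow_submod scale I (m + Suc n)"
    obtain x where x: "prime_ideal p" "p = {r. r *s x \<in> ?L}" using p unfolding Ass_quot_def by blast
    have pS: "p \<in> Supp scale" by (rule Ass_quot_in_Supp[OF p subspace_pow_submod])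
    have "I \<subseteq> p" using Ass_quot_contains[of p I "m + n"] p by simp
    then obtain q1 where "q1 \<in> Ass_quot scale (pow_submod scale I 1)" "q1 \<subseteq> p"
      by (rule Ass_quot_pow_submod_below[OF pS])
    \<comment> \<open>Either \<open>q1\<close> is strictly below \<open>p\<close>, or
      \<open>p = q1\<close> is associated without being minimal and a smaller associated prime
      exists.\<close>
    then obtain q where q: "q \<in> Ass_quot scale (pow_submod scale I 1)" "q \<subset> p"
      using not_min unfolding min_Ass_quot_def by blast
    have qS: "q \<in> Supp scale" by (rule Ass_quot_in_Supp[OF q(1) subspace_pow_submod])
    have Iq: "I \<subseteq> q" using Ass_quot_contains[of q I 0] q(1) by simp
    obtain q0 where q0: "q0 \<in> Ass_quot scale {0}" "q0 \<subseteq> q" by (rule Supp_Ass_below[OF qS])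
    \<comment> \<open>A strict inclusion would give the chain
      \<open>q0 \<subset> q \<subset> p\<close> in the support.\<close>
    then have "q0 = q"
      using dim qS pS q(2) Ass_quot_in_Supp[OF q0(1) subspace_single_0] unfolding dim_le_one_def by blast
    then have "q \<in> loc_Ass scale p" unfolding loc_Ass_eq[OF x(1)] using q0(1) q(2) by blast
    then have loc: "loc_Ass scale p = {q}" using single[OF pS] by blast
    obtain u where u: "u \<notin> p" "\<And>Q y. Q \<in> D0 \<Longrightarrow> \<not> primary_prime scale Q \<subseteq> p \<Longrightarrow> u *s y \<in> Q"
      using dec_components_away_from_prime[OF D0 x(1)] by blast
    \<comment> \<open>A component of zero with prime inside \<open>p\<close> has prime
      \<open>q\<close>, which contains \<open>I\<close>, so it contains \<open>?L\<close> by the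
      choice of \<open>m\<close>; \<open>u\<close> sends \<open>N\<close> into all the others. Thus
      \<open>?L\<close> vanishes at \<open>p\<close>.\<close>
    have kill: "u *s z = 0" if z: "z \<in> ?L" for z
    proof -
      have "u *s z \<in> Q" if Q: "Q \<in> D0" for Q
      proof (cases "primary_prime scale Q \<subseteq> p")
        case True
        then have "primary_prime scale Q \<in> loc_Ass scale p"
          unfolding loc_Ass_eq[OF x(1)] using primary_prime_in_Ass_quot[OF D0 Q] by blast
        then have "Q \<in> ?E" using loc Iq Q by blast
        then have "z \<in> Q" using m z by blast
        moreover have "subspace Q" using D0 Q unfolding min_primary_dec_def primary_submod_def by blast
        ultimately show ?thesis using subspace_scale by blast
      qed (use u(2) Q in blast)
      then show ?thesis using D0 unfolding min_primary_dec_def by blast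
    qed
    \<comment> \<open>Since \<open>u\<close> kills \<open>?L\<close>, the colon ideal of
      \<open>x\<close> modulo \<open>?L\<close> is the annihilator of \<open>u *s x\<close>, which
      makes \<open>p\<close> a second associated prime at \<open>p\<close>.\<close>
    have "p = {r. r *s u *s x \<in> {0}}"
    proof (intro equalityI subsetI)
      fix r assume "r \<in> p"
      then have "u *s r *s x = 0" using x(2) kill by blast
      then show "r \<in> {r. r *s u *s x \<in> {0}}" by (simp add: mult.commute)
    next
      fix r assume "r \<in> {r. r *s u *s x \<in> {0}}"
      then have "(r * u) *s x \<in> ?L" using subspace_0[OF subspace_pow_submod] by simp
      then have "r * u \<in> p" using x(2) by blast
      then show "r \<in> p" using prime_ideal_mult_iff[OF x(1)] u(1) by blast
    qed
    then have "p \<in> loc_Ass scale p" unfolding loc_Ass_eq[OF x(1)] Ass_quot_def using x(1) by blast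
    then show False using loc q(2) by blast
  qed
  \<comment> \<open>The shift \<open>Suc m\<close> keeps the exponent in the form covered by
    \<open>unmixed\<close> even for \<open>n = 0\<close>. All components then count, so the symbolic
    power is the ordinary one.\<close>
  have "symb_power scale I (n + Suc m) \<subseteq> pow_submod scale I n" for n
  proof (rule symb_power_dec[of I "n + Suc m"])
    fix D
    assume D: "min_primary_dec scale (pow_submod scale I (n + Suc m)) D"
      and eq: "symb_power scale I (n + Suc m) =
        \<Inter>{Q \<in> D. primary_prime scale Q \<in> min_Ass_quot scale (pow_submod scale I 1)}"
    have "primary_prime scale Q \<in> min_Ass_quot scale (pow_submod scale I 1)" if "Q \<in> D" for Q
      using unmixed[of _ n] primary_prime_in_Ass_quot[OF D that] by (simp add: add.commute)
    then have "symb_power scale I (n + Suc m) = \<Inter>D" unfolding eq by blast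
    also have "\<dots> = pow_submod scale I (n + Suc m)" using D unfolding min_primary_dec_def by blast
    also have "\<dots> \<subseteq> pow_submod scale I n" by (rule pow_submod_add_subset)
    finally show ?thesis .
  qed
  then show ?thesis unfolding lin_equiv_topologies_def by blast
qed

end

theorem theorem2p4:
  fixes scale :: "'a::comm_ring_1 \<Rightarrow> 'b::ab_group_add \<Rightarrow> 'b"
  assumes "noetherian_ring TYPE('a)"
    and "module scale"
    and "fin_gen_module scale"
    and "(UNIV :: 'b set) \<noteq> {0}"
  shows "(\<forall>I::'a set. is_ideal I \<and> N_proper scale I \<longrightarrow> lin_equiv_topologies scale I)
     \<longleftrightarrow> (dim_le_one scale \<and> (\<forall>P \<in> Supp scale. \<exists>Q. loc_Ass scale P = {Q}))"
proof -
  interpret noetherian_module scale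
    using assms(1-3) by (simp add: noetherian_module_def noetherian_module_axioms_def)
  show ?thesis
  proof
    assume *: "\<forall>I::'a set. is_ideal I \<and> N_proper scale I \<longrightarrow> lin_equiv_topologies scale I"
    show "dim_le_one scale \<and> (\<forall>P \<in> Supp scale. \<exists>Q. loc_Ass scale P = {Q})"
      by (intro conjI ballI dim_le_one_if_lin_equiv loc_Ass_singleton) (use * in auto)
  next
    assume "dim_le_one scale \<and> (\<forall>P \<in> Supp scale. \<exists>Q. loc_Ass scale P = {Q})"
    then show "\<forall>I::'a set. is_ideal I \<and> N_proper scale I \<longrightarrow> lin_equiv_topologies scale I"
      by (intro allI impI lin_equiv_if_dim_le_one) auto
  qed
qed

end
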